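(* There are no braidings on any complex/complex Tambara-Yamagami category in which $m$ is the only Galois nontrivial simple object.
   Context: A complex/complex Tambara-Yamagami category is a fusion category over $\mathbb R$ (an $\mathbb R$-linear finite semisimple rigid monoidal category with simple unit $\mathbb 1$) whose simple objects are the elements of a finite group $A$ of invertible objects together with one non-invertible simple object $m$, with fusion rules $a\otimes b\cong ab$, $a\otimes m\cong m\cong m\otimes a$, and $m\otimes m$ isomorphic to a direct sum of the invertible objects (all with the same positive multiplicity), and such that the endomorphism algebra of every simple object is isomorphic to $\mathbb C$ as an $\mathbb R$-algebra. For a simple object $x$ there are two $\mathbb R$-algebra embeddings $\operatorname{End}(\mathbb 1)\to\operatorname{End}(x)$, given by $z\mapsto z\otimes\mathrm{id}_x$ and $z\mapsto\mathrm{id}_x\otimes z$ conjugated by the left and right unitors respectively. The object $x$ is Galois trivial if these two embeddings coincide and Galois nontrivial otherwise. *)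

theory Defs
  imports "HOL-Algebra.Group" Complex_Main
begin

(* The objects of a category are all elements of the type 'o.  The arrows live in one ambient
   real vector space 'a, of which every Hom set is a linear subspace.  The Hom sets may overlap,
   and composition and tensor product of arrows are only constrained on well-typed arguments.
   An arbitrary small real-linear (monoidal) category has this form: take for 'a the direct sum
   of all Hom spaces, and extend composition and tensor product bilinearly. *)

record ('o, 'a) cat =
  Hom :: "'o \<Rightarrow> 'o \<Rightarrow> 'a set"
  Id :: "'o \<Rightarrow> 'a"
  Comp :: "'a \<Rightarrow> 'a \<Rightarrow> 'a" (infixr "\<cdot>\<index>" 68)

record ('o, 'a) moncat = "('o, 'a) cat" +
  Unit :: "'o"
  TensorObj :: "'o \<Rightarrow> 'o \<Rightarrow> 'o" (infixr "\<odot>\<index>" 75)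
  TensorArr :: "'a \<Rightarrow> 'a \<Rightarrow> 'a" (infixr "\<star>\<index>" 70)
  Assoc :: "'o \<Rightarrow> 'o \<Rightarrow> 'o \<Rightarrow> 'a"  (* (X Y) Z \<rightarrow> X (Y Z) *)
  LUnit :: "'o \<Rightarrow> 'a"  (* 1 X \<rightarrow> X *)
  RUnit :: "'o \<Rightarrow> 'a"  (* X 1 \<rightarrow> X *)


section \<open>Real-linear categories\<close>

locale linear_category =
  fixes C :: "('o, 'a :: real_vector, 'more) cat_scheme" (structure)
  assumes Id_in_Hom: "Id C X \<in> Hom C X X"
    and Comp_in_Hom: "\<lbrakk>f \<in> Hom C X Y; g \<in> Hom C Y Z\<rbrakk> \<Longrightarrow> g \<cdot> f \<in> Hom C X Z"
    and Comp_Id_right: "f \<in> Hom C X Y \<Longrightarrow> f \<cdot> Id C X = f"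
    and Comp_Id_left: "f \<in> Hom C X Y \<Longrightarrow> Id C Y \<cdot> f = f"
    and Comp_assoc: "\<lbrakk>f \<in> Hom C W X; g \<in> Hom C X Y; h \<in> Hom C Y Z\<rbrakk>
          \<Longrightarrow> (h \<cdot> g) \<cdot> f = h \<cdot> (g \<cdot> f)"
    and subspace_Hom: "subspace (Hom C X Y)"
    and Comp_add_left: "\<lbrakk>f \<in> Hom C X Y; g \<in> Hom C Y Z; g' \<in> Hom C Y Z\<rbrakk>
          \<Longrightarrow> (g + g') \<cdot> f = g \<cdot> f + g' \<cdot> f"
    and Comp_add_right: "\<lbrakk>f \<in> Hom C X Y; f' \<in> Hom C X Y; g \<in> Hom C Y Z\<rbrakk>
          \<Longrightarrow> g \<cdot> (f + f') = g \<cdot> f + g \<cdot> f'"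
    and Comp_scale_left: "\<lbrakk>f \<in> Hom C X Y; g \<in> Hom C Y Z\<rbrakk> \<Longrightarrow> (r *\<^sub>R g) \<cdot> f = r *\<^sub>R (g \<cdot> f)"
    and Comp_scale_right: "\<lbrakk>f \<in> Hom C X Y; g \<in> Hom C Y Z\<rbrakk> \<Longrightarrow> g \<cdot> (r *\<^sub>R f) = r *\<^sub>R (g \<cdot> f)"

definition inverse_arrows where
  "inverse_arrows C X Y f g \<longleftrightarrow> f \<in> Hom C X Y \<and> g \<in> Hom C Y X \<and>
     g \<cdot> f = Id C X \<and> f \<cdot> g = Id C Y" for C (structure)

definition is_iso where
  "is_iso C X Y f \<longleftrightarrow> (\<exists>g. inverse_arrows C X Y f g)"

(* The inverse of an isomorphism f : X \<rightarrow> Y. *)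
definition Inv where
  "Inv C X Y f = (THE g. inverse_arrows C X Y f g)"

definition isomorphic where
  "isomorphic C X Y \<longleftrightarrow> (\<exists>f. is_iso C X Y f)"

definition is_mono where
  "is_mono C X Y f \<longleftrightarrow> f \<in> Hom C X Y \<and>
     (\<forall>T. \<forall>g \<in> Hom C T X. \<forall>h \<in> Hom C T X. f \<cdot> g = f \<cdot> h \<longrightarrow> g = h)" for C (structure)

definition is_epi where
  "is_epi C X Y f \<longleftrightarrow> f \<in> Hom C X Y \<and>
     (\<forall>T. \<forall>g \<in> Hom C Y T. \<forall>h \<in> Hom C Y T. g \<cdot> f = h \<cdot> f \<longrightarrow> g = h)" for C (structure)

definition is_kernel where
  "is_kernel C K X Y k f \<longleftrightarrow> k \<in> Hom C K X \<and> f \<in> Hom C X Y \<and> f \<cdot> k = 0 \<and>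
     (\<forall>T. \<forall>h \<in> Hom C T X. f \<cdot> h = 0 \<longrightarrow> (\<exists>!u. u \<in> Hom C T K \<and> k \<cdot> u = h))" for C (structure)

definition is_cokernel where
  "is_cokernel C X Y Q q f \<longleftrightarrow> q \<in> Hom C Y Q \<and> f \<in> Hom C X Y \<and> q \<cdot> f = 0 \<and>
     (\<forall>T. \<forall>h \<in> Hom C Y T. h \<cdot> f = 0 \<longrightarrow> (\<exists>!u. u \<in> Hom C Q T \<and> u \<cdot> q = h))" for C (structure)

definition is_zero_object where
  "is_zero_object C X \<longleftrightarrow> (\<forall>Y. Hom C X Y = {0} \<and> Hom C Y X = {0})"

(* X is a direct sum (biproduct) of the finite family F over I. *)
definition is_direct_sum where
  "is_direct_sum C I F X \<longleftrightarrow> finite I \<and>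
     (\<exists>inj proj. (\<forall>i\<in>I. inj i \<in> Hom C (F i) X \<and> proj i \<in> Hom C X (F i)) \<and>
        (\<forall>i\<in>I. \<forall>j\<in>I. proj i \<cdot> inj j = (if i = j then Id C (F i) else 0)) \<and>
        (\<Sum>i\<in>I. inj i \<cdot> proj i) = Id C X)" for C (structure)

definition simple where
  "simple C X \<longleftrightarrow> \<not> is_zero_object C X \<and>
     (\<forall>Y f. is_mono C Y X f \<longrightarrow> is_zero_object C Y \<or> is_iso C Y X f)"

locale abelian_linear_category = linear_category +
  assumes ex_direct_sum: "\<exists>X. is_direct_sum C {..<n :: nat} F X"
    and ex_kernel: "f \<in> Hom C X Y \<Longrightarrow> \<exists>K k. is_kernel C K X Y k f"
    and ex_cokernel: "f \<in> Hom C X Y \<Longrightarrow> \<exists>Q q. is_cokernel C X Y Q q f"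
    and mono_is_kernel: "is_mono C X Y f \<Longrightarrow> \<exists>Z g. is_kernel C X Y Z f g"
    and epi_is_cokernel: "is_epi C X Y f \<Longrightarrow> \<exists>Z g. is_cokernel C Z X Y f g"

locale finite_semisimple_category = abelian_linear_category +
  assumes semisimple: "\<exists>(n :: nat) F. (\<forall>i<n. simple C (F i)) \<and> is_direct_sum C {..<n} F X"
    and finite_dimensional_Hom: "\<exists>B. finite B \<and> Hom C X Y = span B"
    and finitely_many_simples: "\<exists>S. finite S \<and> (\<forall>X. simple C X \<longrightarrow> (\<exists>Y\<in>S. isomorphic C X Y))"


section \<open>Monoidal and fusion categories\<close>

locale linear_monoidal_category = linear_category C
  for C :: "('o, 'a :: real_vector, 'more) moncat_scheme" (structure) +
  assumes Tensor_in_Hom: "\<lbrakk>f \<in> Hom C X X'; g \<in> Hom C Y Y'\<rbrakk>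
          \<Longrightarrow> f \<star> g \<in> Hom C (X \<odot> Y) (X' \<odot> Y')"
    and Tensor_Id: "Id C X \<star> Id C Y = Id C (X \<odot> Y)"
    and Tensor_Comp: "\<lbrakk>f \<in> Hom C X X'; f' \<in> Hom C X' X''; g \<in> Hom C Y Y'; g' \<in> Hom C Y' Y''\<rbrakk>
          \<Longrightarrow> (f' \<cdot> f) \<star> (g' \<cdot> g) = (f' \<star> g') \<cdot> (f \<star> g)"
    and Tensor_add_left: "\<lbrakk>f \<in> Hom C X X'; f' \<in> Hom C X X'; g \<in> Hom C Y Y'\<rbrakk>
          \<Longrightarrow> (f + f') \<star> g = f \<star> g + f' \<star> g"
    and Tensor_add_right: "\<lbrakk>f \<in> Hom C X X'; g \<in> Hom C Y Y'; g' \<in> Hom C Y Y'\<rbrakk>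
          \<Longrightarrow> f \<star> (g + g') = f \<star> g + f \<star> g'"
    and Tensor_scale_left: "\<lbrakk>f \<in> Hom C X X'; g \<in> Hom C Y Y'\<rbrakk>
          \<Longrightarrow> (r *\<^sub>R f) \<star> g = r *\<^sub>R (f \<star> g)"
    and Tensor_scale_right: "\<lbrakk>f \<in> Hom C X X'; g \<in> Hom C Y Y'\<rbrakk>
          \<Longrightarrow> f \<star> (r *\<^sub>R g) = r *\<^sub>R (f \<star> g)"
    and Assoc_iso: "is_iso C ((X \<odot> Y) \<odot> Z) (X \<odot> (Y \<odot> Z)) (Assoc C X Y Z)"
    and LUnit_iso: "is_iso C (Unit C \<odot> X) X (LUnit C X)"
    and RUnit_iso: "is_iso C (X \<odot> Unit C) X (RUnit C X)"
    and Assoc_natural: "\<lbrakk>f \<in> Hom C X X'; g \<in> Hom C Y Y'; h \<in> Hom C Z Z'\<rbrakk>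
          \<Longrightarrow> Assoc C X' Y' Z' \<cdot> ((f \<star> g) \<star> h) = (f \<star> (g \<star> h)) \<cdot> Assoc C X Y Z"
    and LUnit_natural: "f \<in> Hom C X X' \<Longrightarrow> LUnit C X' \<cdot> (Id C (Unit C) \<star> f) = f \<cdot> LUnit C X"
    and RUnit_natural: "f \<in> Hom C X X' \<Longrightarrow> RUnit C X' \<cdot> (f \<star> Id C (Unit C)) = f \<cdot> RUnit C X"
    and pentagon: "Assoc C W X (Y \<odot> Z) \<cdot> Assoc C (W \<odot> X) Y Z
          = (Id C W \<star> Assoc C X Y Z) \<cdot> Assoc C W (X \<odot> Y) Z \<cdot> (Assoc C W X Y \<star> Id C Z)"
    and triangle: "(Id C X \<star> LUnit C Y) \<cdot> Assoc C X (Unit C) Y = RUnit C X \<star> Id C Y"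

(* D is a left dual of X (equivalently, X is a right dual of D), with evaluation D X \<rightarrow> 1 and
   coevaluation 1 \<rightarrow> X D. *)
definition is_left_dual where
  "is_left_dual C X D \<longleftrightarrow>
     (\<exists>ev coev. ev \<in> Hom C (D \<odot> X) (Unit C) \<and> coev \<in> Hom C (Unit C) (X \<odot> D) \<and>
        RUnit C X \<cdot> (Id C X \<star> ev) \<cdot> Assoc C X D X \<cdot> (coev \<star> Id C X)
          \<cdot> Inv C (Unit C \<odot> X) X (LUnit C X) = Id C X \<and>
        LUnit C D \<cdot> (ev \<star> Id C D) \<cdot> Inv C ((D \<odot> X) \<odot> D) (D \<odot> (X \<odot> D)) (Assoc C D X D)
          \<cdot> (Id C D \<star> coev) \<cdot> Inv C (D \<odot> Unit C) D (RUnit C D) = Id C D)" for C (structure)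

locale fusion_category = finite_semisimple_category C + linear_monoidal_category C
  for C :: "('o, 'a :: real_vector, 'more) moncat_scheme" (structure) +
  assumes left_rigid: "\<exists>D. is_left_dual C X D"
    and right_rigid: "\<exists>D. is_left_dual C D X"
    and simple_Unit: "simple C (Unit C)"

definition invertible_object where
  "invertible_object C X \<longleftrightarrow>
     (\<exists>Y. isomorphic C (X \<odot> Y) (Unit C) \<and> isomorphic C (Y \<odot> X) (Unit C))" for C (structure)

definition End_is_complex where
  "End_is_complex C X \<longleftrightarrow>
     (\<exists>\<phi> :: complex \<Rightarrow> 'a. linear \<phi> \<and> bij_betw \<phi> UNIV (Hom C X X) \<and>
        \<phi> 1 = Id C X \<and> (\<forall>z w. \<phi> (z * w) = \<phi> z \<cdot> \<phi> w))"
  for C :: "('o, 'a :: real_vector, 'more) cat_scheme" (structure)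


section \<open>Complex/complex Tambara-Yamagami categories\<close>

(* The simple objects are given up to isomorphism, by pairwise non-isomorphic representatives
   ob a, for a in the group A, and m. *)
locale complex_complex_Tambara_Yamagami = fusion_category C + A: group A
  for C :: "('o, 'a :: real_vector, 'more) moncat_scheme" (structure)
    and A :: "('g, 'b) monoid_scheme" and ob :: "'g \<Rightarrow> 'o" and m :: 'o +
  assumes finite_group: "finite (carrier A)"
    and simple_ob: "a \<in> carrier A \<Longrightarrow> simple C (ob a)"
    and simple_m: "simple C m"
    and simple_cases: "simple C X \<Longrightarrow> (\<exists>a\<in>carrier A. isomorphic C X (ob a)) \<or> isomorphic C X m"
    and ob_inj: "\<lbrakk>a \<in> carrier A; b \<in> carrier A; isomorphic C (ob a) (ob b)\<rbrakk> \<Longrightarrow> a = b"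
    and invertible_ob: "a \<in> carrier A \<Longrightarrow> invertible_object C (ob a)"
    and not_invertible_m: "\<not> invertible_object C m"
    and fusion_ob_ob: "\<lbrakk>a \<in> carrier A; b \<in> carrier A\<rbrakk>
          \<Longrightarrow> isomorphic C (ob a \<odot> ob b) (ob (a \<otimes>\<^bsub>A\<^esub> b))"
    and fusion_ob_m: "a \<in> carrier A \<Longrightarrow> isomorphic C (ob a \<odot> m) m"
    and fusion_m_ob: "a \<in> carrier A \<Longrightarrow> isomorphic C (m \<odot> ob a) m"
    and fusion_m_m: "\<exists>k :: nat. k > 0 \<and>
          is_direct_sum C (carrier A \<times> {..<k}) (\<lambda>(a, i). ob a) (m \<odot> m)"
    and End_simple: "simple C X \<Longrightarrow> End_is_complex C X"


section \<open>Galois triviality and braidings\<close>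

definition left_embedding where
  "left_embedding C X z =
     LUnit C X \<cdot> (z \<star> Id C X) \<cdot> Inv C (Unit C \<odot> X) X (LUnit C X)" for C (structure)

definition right_embedding where
  "right_embedding C X z =
     RUnit C X \<cdot> (Id C X \<star> z) \<cdot> Inv C (X \<odot> Unit C) X (RUnit C X)" for C (structure)

definition Galois_trivial where
  "Galois_trivial C X \<longleftrightarrow>
     (\<forall>z \<in> Hom C (Unit C) (Unit C). left_embedding C X z = right_embedding C X z)"

definition Galois_nontrivial where
  "Galois_nontrivial C X \<longleftrightarrow> \<not> Galois_trivial C X"

definition is_braiding where
  "is_braiding C \<sigma> \<longleftrightarrow>
     (\<forall>X Y. is_iso C (X \<odot> Y) (Y \<odot> X) (\<sigma> X Y)) \<and>
     (\<forall>X X' Y Y'. \<forall>f \<in> Hom C X X'. \<forall>g \<in> Hom C Y Y'.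
        \<sigma> X' Y' \<cdot> (f \<star> g) = (g \<star> f) \<cdot> \<sigma> X Y) \<and>
     (\<forall>X Y Z. Assoc C Y Z X \<cdot> \<sigma> X (Y \<odot> Z) \<cdot> Assoc C X Y Z
        = (Id C Y \<star> \<sigma> X Z) \<cdot> Assoc C Y X Z \<cdot> (\<sigma> X Y \<star> Id C Z)) \<and>
     (\<forall>X Y Z. Inv C ((Z \<odot> X) \<odot> Y) (Z \<odot> (X \<odot> Y)) (Assoc C Z X Y) \<cdot> \<sigma> (X \<odot> Y) Z
          \<cdot> Inv C ((X \<odot> Y) \<odot> Z) (X \<odot> (Y \<odot> Z)) (Assoc C X Y Z)
        = (\<sigma> X Z \<star> Id C Y) \<cdot> Inv C ((X \<odot> Z) \<odot> Y) (X \<odot> (Z \<odot> Y)) (Assoc C X Z Y)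
          \<cdot> (Id C X \<star> \<sigma> Y Z))" for C (structure)

end

theory Submission
  imports Defs
begin

text \<open>Naturality of a braiding $\sigma$ at $z \in \mathrm{End}(\mathbb 1)$ and $\mathrm{id}_X$ gives
  $\sigma_{\mathbb 1,X}(z \otimes \mathrm{id}_X) = (\mathrm{id}_X \otimes z)\sigma_{\mathbb 1,X}$, so the two
  embeddings of $\mathrm{End}(\mathbb 1)$ into $\mathrm{End}(X)$ are conjugate by the automorphism
  $\rho_X \sigma_{\mathbb 1,X} \lambda_X^{-1}$ of $X$. They coincide as soon as $\mathrm{End}(X)$ is
  commutative, so $m$ would be Galois trivial.\<close>

context linear_category
begin

lemma inverse_arrows_unique:
  assumes "inverse_arrows C X Y f g" and "inverse_arrows C X Y f h"
  shows "g = h"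
proof -
  have f: "f \<in> Hom C X Y" and g: "g \<in> Hom C Y X" "f \<cdot> g = Id C Y"
    and h: "h \<in> Hom C Y X" "h \<cdot> f = Id C X"
    using assms by (simp_all add: inverse_arrows_def)
  have "(h \<cdot> f) \<cdot> g = h \<cdot> (f \<cdot> g)"
    by (rule Comp_assoc[OF g(1) f h(1)])
  then show ?thesis
    by (simp only: g(2) h(2) Comp_Id_left[OF g(1)] Comp_Id_right[OF h(1)])
qed

text \<open>\<open>Inv\<close> is a definite description, so it says nothing until an inverse is
  known to exist and to be unique. This turns it into an arrow that can be computed with.\<close>

lemma inverse_arrows_Inv:
  assumes "is_iso C X Y f"
  shows "inverse_arrows C X Y f (Inv C X Y f)"
proof -
  obtain g where "inverse_arrows C X Y f g"
    using assms by (auto simp: is_iso_def)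
  then show ?thesis
    unfolding Inv_def by (rule theI) (rule inverse_arrows_unique[OF _ \<open>inverse_arrows C X Y f g\<close>])
qed

lemma is_iso_Inv:
  assumes "is_iso C X Y f"
  shows "is_iso C Y X (Inv C X Y f)"
  using inverse_arrows_Inv[OF assms] by (auto simp: is_iso_def inverse_arrows_def)

lemma is_iso_Comp:
  assumes "is_iso C X Y f" and "is_iso C Y Z g"
  shows "is_iso C X Z (g \<cdot> f)"
proof -
  obtain f' g' where f: "f \<in> Hom C X Y" "f' \<in> Hom C Y X" "f' \<cdot> f = Id C X" "f \<cdot> f' = Id C Y"
    and g: "g \<in> Hom C Y Z" "g' \<in> Hom C Z Y" "g' \<cdot> g = Id C Y" "g \<cdot> g' = Id C Z"
    using assms by (auto simp: is_iso_def inverse_arrows_def)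
  \<comment> \<open>Associativity holds only for well-typed arrows, and the intermediate objects
    cannot be read off the terms. Each rebracketing therefore uses an explicitly typed instance of
    \<open>Comp_assoc\<close>.\<close>
  have "(f' \<cdot> g') \<cdot> (g \<cdot> f) = f' \<cdot> ((g' \<cdot> g) \<cdot> f)"
    by (simp only: Comp_assoc[OF Comp_in_Hom[OF f(1) g(1)] g(2) f(2)] Comp_assoc[OF f(1) g(1,2)])
  moreover have "(g \<cdot> f) \<cdot> (f' \<cdot> g') = g \<cdot> ((f \<cdot> f') \<cdot> g')"
    by (simp only: Comp_assoc[OF Comp_in_Hom[OF g(2) f(2)] f(1) g(1)] Comp_assoc[OF g(2) f(2,1)])
  ultimately have "inverse_arrows C X Z (g \<cdot> f) (f' \<cdot> g')"
    using f g Comp_in_Hom[OF f(1) g(1)] Comp_in_Hom[OF g(2) f(2)]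
    by (simp add: inverse_arrows_def Comp_Id_left[OF f(1)] Comp_Id_left[OF g(2)])
  then show ?thesis by (auto simp: is_iso_def)
qed

lemma is_iso_Comp_cancel:
  assumes f: "is_iso C Y Z f" and g: "g \<in> Hom C X Y" "h \<in> Hom C X Y" and eq: "f \<cdot> g = f \<cdot> h"
  shows "g = h"
proof -
  obtain f' where f': "f \<in> Hom C Y Z" "f' \<in> Hom C Z Y" "f' \<cdot> f = Id C Y"
    using f by (auto simp: is_iso_def inverse_arrows_def)
  have "f' \<cdot> (f \<cdot> g) = g" "f' \<cdot> (f \<cdot> h) = h"
    using Comp_assoc[OF g(1) f'(1,2)] Comp_assoc[OF g(2) f'(1,2)] f'(3)
    by (simp_all add: Comp_Id_left[OF g(1)] Comp_Id_left[OF g(2)])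
  then show ?thesis unfolding eq by (rule trans[OF sym])
qed

end

text \<open>\<open>\<phi>\<close> is multiplicative and onto, so commutativity passes from the
  complex numbers to the endomorphisms.\<close>

lemma End_is_complex_commute:
  fixes C :: "('o, 'a :: real_vector, 'more) cat_scheme" (structure)
  assumes "End_is_complex C X" and "f \<in> Hom C X X" and "g \<in> Hom C X X"
  shows "f \<cdot> g = g \<cdot> f"
proof -
  obtain \<phi> :: "complex \<Rightarrow> 'a" where \<phi>: "bij_betw \<phi> UNIV (Hom C X X)"
      "\<And>z w. \<phi> (z * w) = \<phi> z \<cdot> \<phi> w"
    using assms(1) by (auto simp: End_is_complex_def)
  obtain z w where "f = \<phi> z" "g = \<phi> w"
    using assms(2,3) bij_betw_imp_surj_on[OF \<phi>(1)] by blast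
  then show ?thesis by (simp add: \<phi>(2)[symmetric] mult.commute)
qed

lemma (in linear_monoidal_category) braiding_imp_Galois_trivial:
  assumes braiding: "is_braiding C \<sigma>"
    and commute: "\<And>f g. \<lbrakk>f \<in> Hom C X X; g \<in> Hom C X X\<rbrakk> \<Longrightarrow> f \<cdot> g = g \<cdot> f"
  shows "Galois_trivial C X"
  unfolding Galois_trivial_def
proof
  fix z assume z: "z \<in> Hom C (Unit C) (Unit C)"
  define l where "l = LUnit C X"
  define l' where "l' = Inv C (Unit C \<odot> X) X l"
  define r where "r = RUnit C X"
  define r' where "r' = Inv C (X \<odot> Unit C) X r"
  define s where "s = \<sigma> (Unit C) X"
  define p where "p = z \<star> Id C X"
  define q where "q = Id C X \<star> z"
  \<comment> \<open>This is the automorphism of \<open>X\<close> that conjugates one embedding into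
    the other.\<close>
  define u where "u = r \<cdot> s \<cdot> l'"
  have iso: "is_iso C (Unit C \<odot> X) X l" "is_iso C (X \<odot> Unit C) X r"
      "is_iso C (Unit C \<odot> X) (X \<odot> Unit C) s"
    using braiding by (simp_all add: l_def r_def s_def LUnit_iso RUnit_iso is_braiding_def)
  have l: "l \<in> Hom C (Unit C \<odot> X) X" "l' \<in> Hom C X (Unit C \<odot> X)" "l' \<cdot> l = Id C (Unit C \<odot> X)"
    and r: "r \<in> Hom C (X \<odot> Unit C) X" "r' \<in> Hom C X (X \<odot> Unit C)" "r' \<cdot> r = Id C (X \<odot> Unit C)"
    using inverse_arrows_Inv[OF iso(1)] inverse_arrows_Inv[OF iso(2)]
    by (simp_all add: inverse_arrows_def l'_def r'_def)
  have s: "s \<in> Hom C (Unit C \<odot> X) (X \<odot> Unit C)"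
    using iso(3) by (auto simp: is_iso_def inverse_arrows_def)
  have p: "p \<in> Hom C (Unit C \<odot> X) (Unit C \<odot> X)" and q: "q \<in> Hom C (X \<odot> Unit C) (X \<odot> Unit C)"
    using z Id_in_Hom by (auto simp: p_def q_def intro: Tensor_in_Hom)
  have natural: "s \<cdot> p = q \<cdot> s"
    using braiding z Id_in_Hom by (auto simp: is_braiding_def s_def p_def q_def)
  have u: "is_iso C X X u"
    unfolding u_def l'_def by (rule is_iso_Comp[OF is_iso_Comp[OF is_iso_Inv[OF iso(1)] iso(3)] iso(2)])
  have u_Hom: "u \<in> Hom C X X"
    using u by (auto simp: is_iso_def inverse_arrows_def)
  have pl': "p \<cdot> l' \<in> Hom C X (Unit C \<odot> X)" and sl': "s \<cdot> l' \<in> Hom C X (X \<odot> Unit C)"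
    by (rule Comp_in_Hom[OF l(2) p], rule Comp_in_Hom[OF l(2) s])
  \<comment> \<open>These two arrows are the images of \<open>z\<close> under the left and the right
    embedding. The chain below shows \<open>u \<cdot> L = R \<cdot> u\<close>.\<close>
  have L: "l \<cdot> p \<cdot> l' \<in> Hom C X X" and R: "r \<cdot> q \<cdot> r' \<in> Hom C X X"
    by (rule Comp_in_Hom[OF pl' l(1)], rule Comp_in_Hom[OF Comp_in_Hom[OF r(2) q] r(1)])
  have "u \<cdot> (l \<cdot> p \<cdot> l') = r \<cdot> ((s \<cdot> l') \<cdot> (l \<cdot> (p \<cdot> l')))"
    unfolding u_def by (rule Comp_assoc[OF L Comp_in_Hom[OF l(2) s] r(1)])
  also have "(s \<cdot> l') \<cdot> (l \<cdot> (p \<cdot> l')) = s \<cdot> (l' \<cdot> (l \<cdot> (p \<cdot> l')))"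
    by (rule Comp_assoc[OF L l(2) s])
  also have "l' \<cdot> (l \<cdot> (p \<cdot> l')) = p \<cdot> l'"
    using Comp_assoc[OF pl' l(1,2)] l(3) Comp_Id_left[OF pl'] by simp
  also have "s \<cdot> (p \<cdot> l') = (s \<cdot> p) \<cdot> l'"
    by (rule Comp_assoc[OF l(2) p s, symmetric])
  also have "(s \<cdot> p) \<cdot> l' = q \<cdot> (s \<cdot> l')"
    unfolding natural by (rule Comp_assoc[OF l(2) s q])
  \<comment> \<open>Inserting \<open>r' \<cdot> r\<close>, an identity, makes \<open>u\<close>
    reappear, now on the right.\<close>
  also have "s \<cdot> l' = r' \<cdot> u"
    using Comp_assoc[OF sl' r(1,2)] r(3) Comp_Id_left[OF sl'] by (simp add: u_def)
  also have "r \<cdot> (q \<cdot> (r' \<cdot> u)) = r \<cdot> ((q \<cdot> r') \<cdot> u)"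
    by (simp add: Comp_assoc[OF u_Hom r(2) q])
  also have "\<dots> = (r \<cdot> q \<cdot> r') \<cdot> u"
    by (rule Comp_assoc[OF u_Hom Comp_in_Hom[OF r(2) q] r(1), symmetric])
  \<comment> \<open>Commutativity moves \<open>u\<close> back to the left, where it can be cancelled
    because it is invertible.\<close>
  also have "\<dots> = u \<cdot> (r \<cdot> q \<cdot> r')"
    by (rule commute[OF R u_Hom])
  finally have "l \<cdot> p \<cdot> l' = r \<cdot> q \<cdot> r'"
    by (rule is_iso_Comp_cancel[OF u L R])
  then show "left_embedding C X z = right_embedding C X z"
    by (simp add: left_embedding_def right_embedding_def l_def l'_def r_def r'_def p_def q_def)
qed

theorem lemma8p2:
  fixes C :: "('o, 'a :: real_vector, 'more) moncat_scheme"
    and A :: "('g, 'b) monoid_scheme" and ob :: "'g \<Rightarrow> 'o" and m :: 'o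
  assumes "complex_complex_Tambara_Yamagami C A ob m"
    and "Galois_nontrivial C m"
    and "\<And>X. \<lbrakk>simple C X; Galois_nontrivial C X\<rbrakk> \<Longrightarrow> isomorphic C X m"
  shows "\<nexists>\<sigma>. is_braiding C \<sigma>"
proof
  interpret complex_complex_Tambara_Yamagami C A ob m by (rule assms(1))
  assume "\<exists>\<sigma>. is_braiding C \<sigma>"
  then obtain \<sigma> where "is_braiding C \<sigma>" ..
  \<comment> \<open>Since \<open>m\<close> is simple, its endomorphism algebra is a copy of the
    complex numbers, hence commutative.\<close>
  then have "Galois_trivial C m"
    using End_is_complex_commute[OF End_simple[OF simple_m]]
    by (rule braiding_imp_Galois_trivial)
  with assms(2) show False by (simp add: Galois_nontrivial_def)
qed

end
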